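(* Let $\underline Q$ be an arbitrary lower transition rate operator and let $L_t^s$ ($0\le t\le s$) be the lower transition operators corresponding to $\underline Q$. Then for all $t,s\in\mathbb R_{\ge0}$ such that $t\le s$, $$\frac{\partial}{\partial t}L_t^s=-\underline QL_t^s\qquad\text{and}\qquad\frac{\partial}{\partial s}L_t^s=\underline QL_t^s,$$ where the derivatives are taken with respect to the operator norm. (If $0=t<s$, the derivative with respect to $t$ is a right derivative. If $t=s$, the derivative with respect to $s$ is a right derivative, and the derivative with respect to $t$ is a left derivative, which is disregarded if $t=0$.)
   Context: $\mathcal X$ is a fixed finite non-empty set; $\mathcal L(\mathcal X)$ is the set of all $f:\mathcal X\to\mathbb R$, with $\|f\|=\max_x|f(x)|$; inequalities between functions are pointwise. A non-negatively homogeneous operator $A:\mathcal L(\mathcal X)\to\mathcal L(\mathcal X)$ has norm $\|A\|=\sup\{\|Af\|:\|f\|=1\}$. $I$ is the identity. Derivatives in operator norm: $\frac{\partial}{\partial s}L_t^s=B$ means $\lim_{\Delta\to0}\|\frac{L_t^{s+\Delta}-L_t^s}{\Delta}-B\|=0$, with $\Delta\neq 0$ ranging over values such that $t\le s+\Delta$; $\frac{\partial}{\partial t}L_t^s=B$ means $\lim_{\Delta\to0}\|\frac{L_{t+\Delta}^{s}-L_t^s}{\Delta}-B\|=0$, with $\Delta\ne0$ ranging over values such that $0\le t+\Delta\le s$. A lower transition rate operator is a map $\underline Q:\mathcal L(\mathcal X)\to\mathcal L(\mathcal X)$ such that for all $f,g\in\mathcal L(\mathcal X)$, $\lambda\ge0$,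 constant functions $\mu$ and $x,y\in\mathcal X$: $[\underline Q\mu](x)=0$; $[\underline Q\mathbb I_y](x)\ge0$ if $x\ne y$; $\underline Q(f+g)\ge\underline Qf+\underline Qg$; $\underline Q(\lambda f)=\lambda\underline Qf$. A lower transition operator is a map $\underline T:\mathcal L(\mathcal X)\to\mathcal L(\mathcal X)$ with $[\underline Tf](x)\ge\min f$, $\underline T(f+g)\ge\underline Tf+\underline Tg$ and $\underline T(\lambda f)=\lambda\underline Tf$ for $\lambda\ge0$. For $t\le s$, $\mathcal U_{[t,s]}$ is the set of finite sequences $u:\ t=t_0<t_1<\dots<t_n=s$; $\Delta_i=t_i-t_{i-1}$, $\sigma(u)=\max_i\Delta_i$ ($0$ if $n=0$), $\Phi_u=(I+\Delta_1\underline Q)\cdots(I+\Delta_n\underline Q)$ (composition; $I$ if $n=0$). The lower transition operator $L_t^s$ corresponding to $\underline Q$ is the (existing, unique) lower transition operator such that for every $\epsilon>0$ there is $\delta>0$ with $\|L_t^s-\Phi_u\|\le\epsilon$ for all $u\in\mathcal U_{[t,s]}$ with $\sigma(u)\le\delta$. *)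

theory Defs
  imports "HOL-Analysis.Analysis"
begin

text \<open>The state space is the finite (and automatically non-empty) type \<open>'x\<close>; an operator is an
  arbitrary, in general non-linear, map on \<open>'x \<Rightarrow> real\<close>.\<close>

type_synonym 'x operator = "('x \<Rightarrow> real) \<Rightarrow> ('x \<Rightarrow> real)"

definition max_norm :: "('x::finite \<Rightarrow> real) \<Rightarrow> real" where
  "max_norm f = Max (range (\<lambda>x. \<bar>f x\<bar>))"

text \<open>The supremum is taken in the extended reals, where it exists without a boundedness proviso,
  so that a small norm is never an artefact of an ill-defined supremum.\<close>

definition op_norm :: "('x::finite) operator \<Rightarrow> ereal" where
  "op_norm A = (SUP f\<in>{f. max_norm f = 1}. ereal (max_norm (A f)))"

definition lower_transition_rate_operator :: "('x::finite) operator \<Rightarrow> bool" where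
  "lower_transition_rate_operator Q \<longleftrightarrow>
     (\<forall>\<mu> x. Q (\<lambda>_. \<mu>) x = 0) \<and>
     (\<forall>x y. x \<noteq> y \<longrightarrow> Q (indicator {y}) x \<ge> 0) \<and>
     (\<forall>f g x. Q (\<lambda>z. f z + g z) x \<ge> Q f x + Q g x) \<and>
     (\<forall>f c x. c \<ge> 0 \<longrightarrow> Q (\<lambda>z. c * f z) x = c * Q f x)"

definition lower_transition_operator :: "('x::finite) operator \<Rightarrow> bool" where
  "lower_transition_operator T \<longleftrightarrow>
     (\<forall>f x. T f x \<ge> Min (range f)) \<and>
     (\<forall>f g x. T (\<lambda>z. f z + g z) x \<ge> T f x + T g x) \<and>
     (\<forall>f c x. c \<ge> 0 \<longrightarrow> T (\<lambda>z. c * f z) x = c * T f x)"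

text \<open>The sequence \<open>t = t\<^sub>0 < \<dots> < t\<^sub>n = s\<close> is the list \<open>[t\<^sub>0, \<dots>, t\<^sub>n]\<close>, of length \<open>n + 1\<close>.\<close>

definition subdivisions :: "real \<Rightarrow> real \<Rightarrow> real list set" where
  "subdivisions t s = {u. u \<noteq> [] \<and> sorted_wrt (<) u \<and> hd u = t \<and> last u = s}"

definition steps :: "real list \<Rightarrow> real list" where
  "steps u = map (\<lambda>i. u ! i - u ! (i - 1)) [1..<length u]"

text \<open>All steps of a subdivision are positive, so inserting \<open>0\<close> only matters when there are none.\<close>

definition mesh :: "real list \<Rightarrow> real" where
  "mesh u = Max (insert 0 (set (steps u)))"

definition Phi :: "('x::finite) operator \<Rightarrow> real list \<Rightarrow> 'x operator" where
  "Phi Q u = foldr (\<circ>) (map (\<lambda>\<Delta> f x. f x + \<Delta> * Q f x) (steps u)) id"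

text \<open>Only meaningful for a lower transition rate operator \<open>Q\<close> and \<open>t \<le> s\<close>, in which case the
  described operator exists and is unique.\<close>

definition L :: "('x::finite) operator \<Rightarrow> real \<Rightarrow> real \<Rightarrow> 'x operator" where
  "L Q t s = (THE T. lower_transition_operator T \<and>
     (\<forall>\<epsilon>>0. \<exists>\<delta>>0. \<forall>u\<in>subdivisions t s. mesh u \<le> \<delta> \<longrightarrow>
        op_norm (\<lambda>f x. T f x - Phi Q u f x) \<le> ereal \<epsilon>))"

text \<open>\<open>B\<close> is the derivative at \<open>r\<close>, in operator norm, of the operator-valued map \<open>F\<close> on the
  parameter set \<open>S\<close>. It is one-sided if \<open>r\<close> is an end point of the interval \<open>S\<close>, and the condition
  is void if \<open>S = {r}\<close>.\<close>

definition has_op_derivative ::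
    "(real \<Rightarrow> ('x::finite) operator) \<Rightarrow> 'x operator \<Rightarrow> real \<Rightarrow> real set \<Rightarrow> bool" where
  "has_op_derivative F B r S \<longleftrightarrow>
     ((\<lambda>\<Delta>. op_norm (\<lambda>f x. (F (r + \<Delta>) f x - F r f x) / \<Delta> - B f x)) \<longlongrightarrow> 0)
       (at 0 within {\<Delta>. r + \<Delta> \<in> S})"

end

theory Submission
  imports Defs
begin

text \<open>An operator \<open>Q\<close> as in the theorem is Lipschitz with some constant \<open>M\<close>, and \<open>I + \<Delta>Q\<close> is a lower
  transition operator, hence non-expansive, when \<open>0 \<le> \<Delta> \<le> 1/M\<close>. A product of such Euler steps of total
  length \<open>d\<close> differs from \<open>I + dQ\<close> by at most \<open>M\<^sup>2d\<^sup>2\<close>; summing this over the blocks of a refinement,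
  any two products of the same total length \<open>d\<close> and of mesh at most \<open>\<sigma>\<close> differ by at most \<open>2M\<^sup>2\<sigma>d\<close>,
  by comparison with a common refinement. So the products converge to a semigroup \<open>T\<close>, with
  \<open>L\<^sub>t\<^sup>s = T\<^bsub>s-t\<^esub>\<close>, and the estimate for a single step gives \<open>\<parallel>T\<^sub>h - (I + hQ)\<parallel> \<le> 2M\<^sup>2h\<^sup>2\<close>. Both derivatives
  follow from this and the semigroup property; for the left-sided ones the Lipschitz continuity of
  \<open>Q\<close> moves the base point.\<close>

section \<open>Maximum norm and operator norm\<close>

lemma abs_le_max_norm: "\<bar>f x\<bar> \<le> max_norm f"
  unfolding max_norm_def by (rule Max_ge) auto

lemma max_norm_le_iff: "max_norm f \<le> c \<longleftrightarrow> (\<forall>x. \<bar>f x\<bar> \<le> c)"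
  unfolding max_norm_def by (subst Max_le_iff) auto

lemma max_norm_nonneg: "0 \<le> max_norm f"
  using abs_le_max_norm[of f undefined] by linarith

lemma max_norm_triangle: "max_norm (\<lambda>x. f x + g x) \<le> max_norm f + max_norm g"
  unfolding max_norm_le_iff
  by (metis abs_le_max_norm abs_triangle_ineq add_mono order_trans)

lemma max_norm_diff_triangle:
  "max_norm (\<lambda>x. f x - h x) \<le> max_norm (\<lambda>x. f x - g x) + max_norm (\<lambda>x. g x - h x)"
  using max_norm_triangle[of "\<lambda>x. f x - g x" "\<lambda>x. g x - h x"] by simp

lemma max_norm_scale: "max_norm (\<lambda>x. c * f x) = \<bar>c\<bar> * max_norm f"
  unfolding max_norm_def abs_mult
  by (subst mono_Max_commute[where f="\<lambda>a. \<bar>c\<bar> * a"])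
    (auto intro!: monoI mult_left_mono simp: image_image)

lemma max_norm_uminus: "max_norm (\<lambda>x. - f x) = max_norm f"
  using max_norm_scale[of "-1" f] by simp

lemma max_norm_minus_commute: "max_norm (\<lambda>x. f x - g x) = max_norm (\<lambda>x. g x - f x)"
  unfolding max_norm_def by (simp add: abs_minus_commute)

lemma max_norm_const: "max_norm (\<lambda>_. c) = \<bar>c\<bar>"
  by (simp add: max_norm_def)

lemma Min_range_ge_uminus_max_norm: "- max_norm f \<le> Min (range f)"
proof (rule Min.boundedI)
  fix a assume "a \<in> range f"
  then obtain x where "a = f x" by blast
  then show "- max_norm f \<le> a" using abs_le_max_norm[of f x] by linarith
qed auto

lemma op_norm_le:
  assumes "\<And>f. max_norm f = 1 \<Longrightarrow> max_norm (A f) \<le> c"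
  shows "op_norm A \<le> ereal c"
  unfolding op_norm_def using assms by (auto intro!: SUP_least)

lemma max_norm_le_op_norm:
  assumes "max_norm f = 1" shows "ereal (max_norm (A f)) \<le> op_norm A"
  unfolding op_norm_def using assms by (auto intro!: SUP_upper)

lemma op_norm_nonneg: "0 \<le> op_norm A"
proof -
  have "0 \<le> ereal (max_norm (A (\<lambda>_. 1)))" by (simp add: max_norm_nonneg)
  also have "\<dots> \<le> op_norm A" by (rule max_norm_le_op_norm) (simp add: max_norm_const)
  finally show ?thesis .
qed

section \<open>Superadditive operators and lower transition operators\<close>

text \<open>Writing \<open>f\<close> as \<open>g + (f - g)\<close> and \<open>g\<close> as
  \<open>f + (g - f)\<close>, superadditivity traps \<open>A f - A g\<close> between
  \<open>A (f - g)\<close> and \<open>- A (g - f)\<close>, so a one-sided bound on \<open>A\<close>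
  suffices. It is applied to lower transition operators with \<open>K = 1\<close> and to
  \<open>Q\<close> with \<open>K = M\<close>.\<close>

lemma superadditive_Lipschitz:
  fixes A :: "('x::finite) operator"
  assumes super: "\<And>f g x. A f x + A g x \<le> A (\<lambda>z. f z + g z) x"
    and lower: "\<And>f x. - (K * max_norm f) \<le> A f x"
  shows "max_norm (\<lambda>x. A f x - A g x) \<le> K * max_norm (\<lambda>x. f x - g x)"
  unfolding max_norm_le_iff
proof
  fix x
  have "A f x + A (\<lambda>z. g z - f z) x \<le> A g x" "A g x + A (\<lambda>z. f z - g z) x \<le> A f x"
    using super[of f x "\<lambda>z. g z - f z"] super[of g x "\<lambda>z. f z - g z"] by simp_all
  then show "\<bar>A f x - A g x\<bar> \<le> K * max_norm (\<lambda>x. f x - g x)"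
    using lower[of "\<lambda>z. g z - f z" x] lower[of "\<lambda>z. f z - g z" x]
    by (simp add: max_norm_minus_commute[of g f] abs_le_iff)
qed

lemma lower_transition_operatorD:
  assumes "lower_transition_operator T"
  shows "Min (range f) \<le> T f x" "T f x + T g x \<le> T (\<lambda>z. f z + g z) x"
    "c \<ge> 0 \<Longrightarrow> T (\<lambda>z. c * f z) x = c * T f x"
  using assms unfolding lower_transition_operator_def by auto

lemma lower_transition_operator_nonexpansive:
  assumes "lower_transition_operator T"
  shows "max_norm (\<lambda>x. T f x - T g x) \<le> max_norm (\<lambda>x. f x - g x)"
proof -
  have "- (1 * max_norm f) \<le> T f x" for f x
    using lower_transition_operatorD(1)[OF assms, of f x] Min_range_ge_uminus_max_norm[of f]
    by linarith
  then show ?thesis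
    using superadditive_Lipschitz[of T 1 f g, OF lower_transition_operatorD(2)[OF assms]] by simp
qed

lemma lower_transition_operator_zero:
  assumes "lower_transition_operator T" shows "T (\<lambda>_. 0) x = 0"
  using lower_transition_operatorD(3)[OF assms, of 0] by simp

lemma lower_transition_operator_norm_le:
  assumes "lower_transition_operator T" shows "max_norm (T f) \<le> max_norm f"
  using lower_transition_operator_nonexpansive[OF assms, of f "\<lambda>_. 0"]
  by (simp add: lower_transition_operator_zero[OF assms])

text \<open>Superadditivity of the composite requires the outer operator to be monotone.
  Monotonicity follows from \<open>g = f + (g - f)\<close>, since \<open>S\<close> is non-negative
  on the non-negative function \<open>g - f\<close>.\<close>

lemma lower_transition_operator_comp:
  assumes S: "lower_transition_operator S" and T: "lower_transition_operator T"
  shows "lower_transition_operator (S \<circ> T)"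
proof -
  have mono: "S f x \<le> S g x" if "\<And>y. f y \<le> g y" for f g x
  proof -
    have "0 \<le> Min (range (\<lambda>y. g y - f y))" using that by (auto intro!: Min.boundedI)
    then have "0 \<le> S (\<lambda>y. g y - f y) x"
      using lower_transition_operatorD(1)[OF S] order_trans by blast
    then show ?thesis
      using lower_transition_operatorD(2)[OF S, of f x "\<lambda>y. g y - f y"] by simp
  qed
  show ?thesis
    unfolding lower_transition_operator_def
  proof (intro conjI allI impI)
    fix f x
    have "Min (range f) \<le> Min (range (T f))"
      using lower_transition_operatorD(1)[OF T] by (auto intro!: Min.boundedI)
    also have "\<dots> \<le> S (T f) x" by (rule lower_transition_operatorD(1)[OF S])
    finally show "Min (range f) \<le> (S \<circ> T) f x" by simp
  next
    fix f g x
    have "S (T f) x + S (T g) x \<le> S (\<lambda>z. T f z + T g z) x"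
      by (rule lower_transition_operatorD(2)[OF S])
    also have "\<dots> \<le> S (T (\<lambda>z. f z + g z)) x"
      by (rule mono) (rule lower_transition_operatorD(2)[OF T])
    finally show "(S \<circ> T) f x + (S \<circ> T) g x \<le> (S \<circ> T) (\<lambda>z. f z + g z) x" by simp
  next
    fix f and c :: real and x assume "0 \<le> c"
    have "T (\<lambda>z. c * f z) = (\<lambda>z. c * T f z)"
      using lower_transition_operatorD(3)[OF T \<open>0 \<le> c\<close>] by auto
    then show "(S \<circ> T) (\<lambda>z. c * f z) x = c * (S \<circ> T) f x"
      using lower_transition_operatorD(3)[OF S \<open>0 \<le> c\<close>] by simp
  qed
qed

text \<open>The operator norm only sees functions of norm 1; homogeneity carries the equality over
  to all others. This serves the uniqueness of \<open>L\<close>.\<close>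

lemma lower_transition_operator_eqI:
  fixes S T :: "('x::finite) operator"
  assumes S: "lower_transition_operator S" and T: "lower_transition_operator T"
    and eq: "\<And>f. max_norm (f :: 'x \<Rightarrow> real) = 1 \<Longrightarrow> S f = T f"
  shows "S = T"
proof (intro ext)
  fix f :: "'x \<Rightarrow> real" and x
  define c where "c = max_norm f"
  show "S f x = T f x"
  proof (cases "c = 0")
    case True
    then have "f = (\<lambda>_. 0)"
      using max_norm_le_iff[of f 0] by (auto simp: c_def)
    then show ?thesis
      by (simp add: lower_transition_operator_zero S T)
  next
    case False
    then have c: "c > 0" using max_norm_nonneg[of f] by (simp add: c_def)
    define g where "g = (\<lambda>x. (1 / c) * f x)"
    have f: "f = (\<lambda>x. c * g x)" using c by (simp add: g_def)
    have "max_norm g = 1" unfolding g_def max_norm_scale using c by (simp add: c_def)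
    then show ?thesis
      using eq[of g] c by (subst (1 2) f) (simp add: lower_transition_operatorD(3) S T)
  qed
qed

section \<open>Common refinements of step lists\<close>

text \<open>The refinement of two step lists is recorded by its two partitions into blocks, \<open>bs\<close> and \<open>cs\<close>.\<close>

lemma common_refinement:
  fixes ds es :: "real list"
  assumes "\<forall>d\<in>set ds. 0 < d" "\<forall>e\<in>set es. 0 < e" "sum_list ds = sum_list es"
  shows "\<exists>bs cs. concat bs = concat cs \<and> map sum_list bs = ds \<and> map sum_list cs = es \<and>
    (\<forall>b\<in>set bs. \<forall>d\<in>set b. 0 < d)"
  using assms
proof (induction "length ds + length es" arbitrary: ds es rule: less_induct)
  case less
  have nil: "zs = []" if "\<forall>z\<in>set zs. 0 < z" "sum_list zs = 0" for zs :: "real list"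
    using that sum_list_nonneg_eq_0_iff[of zs] by (cases zs) force+
  have pos: "\<forall>b\<in>set cs. \<forall>d\<in>set b. 0 < d"
    if "concat bs = concat cs" "\<forall>b\<in>set bs. \<forall>d\<in>set b. (0::real) < d" for bs cs
  proof -
    have "set (concat bs) = set (concat cs)" using that(1) by simp
    then show ?thesis using that(2) by auto
  qed
  \<comment> \<open>The shorter head \<open>d\<close> becomes a block of its own on its side, while
    \<open>e\<close> is cut into \<open>d\<close> and \<open>e - d\<close>. The induction hypothesis
    is applied to the rest, which has fewer entries in total, and \<open>d\<close> is then put in
    front of the block for \<open>e - d\<close>.\<close>
  have step: "\<exists>bs cs. concat bs = concat cs \<and> map sum_list bs = xs \<and> map sum_list cs = ys \<and>
      (\<forall>b\<in>set bs. \<forall>d\<in>set b. 0 < d)"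
    if xs: "xs = d # xs'" and ys: "ys = e # ys'" and le: "d \<le> e"
      and len: "length xs + length ys = length ds + length es"
      and p: "\<forall>d\<in>set xs. 0 < d" "\<forall>e\<in>set ys. 0 < e" and sum: "sum_list xs = sum_list ys"
    for d e and xs xs' ys ys' :: "real list"
  proof (cases "d = e")
    case True
    obtain bs cs where "concat bs = concat cs" "map sum_list bs = xs'" "map sum_list cs = ys'"
      "\<forall>b\<in>set bs. \<forall>d\<in>set b. 0 < d"
      using less.hyps[of xs' ys'] xs ys len p sum True by auto
    then show ?thesis
      using xs ys p True by (intro exI[of _ "[d] # bs"] exI[of _ "[d] # cs"]) auto
  next
    case False
    have "\<exists>bs cs. concat bs = concat cs \<and> map sum_list bs = xs' \<and>
        map sum_list cs = (e - d) # ys' \<and> (\<forall>b\<in>set bs. \<forall>d\<in>set b. 0 < d)"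
      by (rule less.hyps) (use xs ys len p sum False le in auto)
    then obtain bs cs where *: "concat bs = concat cs" "map sum_list bs = xs'"
      "map sum_list cs = (e - d) # ys'" "\<forall>b\<in>set bs. \<forall>d\<in>set b. 0 < d" by metis
    then obtain c cs' where "cs = c # cs'" "sum_list c = e - d" "map sum_list cs' = ys'"
      by (cases cs) auto
    with * show ?thesis
      using xs ys p by (intro exI[of _ "[d] # bs"] exI[of _ "(d # c) # cs'"]) auto
  qed
  show ?case
  proof (cases "ds = [] \<or> es = []")
    case True
    then have "ds = []" "es = []" using nil[of ds] nil[of es] less.prems by auto
    then show ?thesis by (intro exI[of _ "[]"]) simp
  next
    case False
    then obtain d ds' e es' where ds: "ds = d # ds'" and es: "es = e # es'"
      by (metis neq_Nil_conv)
    show ?thesis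
    proof (cases "d \<le> e")
      case True
      then show ?thesis using step[OF ds es] less.prems by blast
    next
      case False
      then obtain bs cs where "concat bs = concat cs" "map sum_list bs = es" "map sum_list cs = ds"
        "\<forall>b\<in>set bs. \<forall>d\<in>set b. 0 < d"
        using step[OF es ds] less.prems by fastforce
      with pos[of bs cs] show ?thesis by metis
    qed
  qed
qed

lemma member_le_sum_list_real:
  fixes xs :: "real list"
  assumes "x \<in> set xs" "\<forall>x\<in>set xs. 0 \<le> x"
  shows "x \<le> sum_list xs"
  using assms
proof (induction xs)
  case (Cons a xs)
  then have "0 \<le> sum_list xs" by (auto intro!: sum_list_nonneg)
  with Cons show ?case by fastforce
qed simp

section \<open>Euler products\<close>

text \<open>\<open>Phi\<close> depends on a subdivision only through its steps. Step lists can be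
  concatenated, grouped into blocks and may contain zeros.\<close>

definition euler :: "('x::finite) operator \<Rightarrow> real list \<Rightarrow> 'x operator" where
  "euler Q ds = foldr (\<circ>) (map (\<lambda>\<Delta> f x. f x + \<Delta> * Q f x) ds) id"

lemma Phi_eq_euler: "Phi Q u = euler Q (steps u)"
  by (simp add: Phi_def euler_def)

lemma euler_Nil [simp]: "euler Q [] f = f"
  by (simp add: euler_def)

lemma euler_Cons [simp]: "euler Q (d # ds) f = (\<lambda>x. euler Q ds f x + d * Q (euler Q ds f) x)"
  by (simp add: euler_def)

lemma euler_append: "euler Q (ds @ es) f = euler Q ds (euler Q es f)"
  by (induction ds) simp_all

text \<open>A zero step is the identity. Such steps occur in uniform lists of total length 0 and are
  removed before \<open>common_refinement\<close>, which asks for positive steps.\<close>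

lemma euler_filter_pos:
  assumes "\<forall>d\<in>set ds. 0 \<le> d"
  shows "euler Q (filter (\<lambda>d. 0 < d) ds) f = euler Q ds f"
  using assms by (induction ds) auto

lemma sum_list_filter_pos:
  assumes "\<forall>d\<in>set ds. (0::real) \<le> d"
  shows "sum_list (filter (\<lambda>d. 0 < d) ds) = sum_list ds"
  using assms by (induction ds) auto

section \<open>Bounds for the rate operator\<close>

locale lower_rate =
  fixes Q :: "('x::finite) operator"
  assumes rate: "lower_transition_rate_operator Q"
begin

lemma Q_const: "Q (\<lambda>_. \<mu>) x = 0"
  and Q_indicator: "x \<noteq> y \<Longrightarrow> 0 \<le> Q (indicator {y}) x"
  and Q_super: "Q f x + Q g x \<le> Q (\<lambda>z. f z + g z) x"
  and Q_scale: "c \<ge> 0 \<Longrightarrow> Q (\<lambda>z. c * f z) x = c * Q f x"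
  using rate unfolding lower_transition_rate_operator_def by auto

lemma Q_super_sum:
  "finite S \<Longrightarrow> (\<Sum>y\<in>S. Q (F y) x) \<le> Q (\<lambda>z. \<Sum>y\<in>S. F y z) x"
proof (induction S rule: finite_induct)
  case (insert a S)
  then show ?case using Q_super[of "F a" x "\<lambda>z. \<Sum>y\<in>S. F y z"] by simp
qed (simp add: Q_const)

text \<open>Expand \<open>f\<close> in indicators with non-negative coefficients and use
  superadditivity and homogeneity. Only the diagonal term can be negative, so the others are
  dropped.\<close>

lemma Q_nonneg_ge:
  assumes "\<And>y. 0 \<le> f y"
  shows "f x * Q (indicator {x}) x \<le> Q f x"
proof -
  have f: "f = (\<lambda>z. \<Sum>y\<in>UNIV. f y * indicator {y} z)"
    by (simp add: indicator_def if_distrib cong: if_cong)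
  have "f x * Q (indicator {x}) x \<le> (\<Sum>y\<in>UNIV. f y * Q (indicator {y}) x)"
    using assms Q_indicator[of x]
    by (subst sum.remove[of _ x]) (auto intro!: sum_nonneg mult_nonneg_nonneg)
  also have "\<dots> = (\<Sum>y\<in>UNIV. Q (\<lambda>z. f y * indicator {y} z) x)"
    using assms by (simp add: Q_scale)
  also have "\<dots> \<le> Q f x"
    using Q_super_sum[of UNIV "\<lambda>y z. f y * indicator {y} z" x, OF finite]
    by (simp only: f[symmetric])
  finally show ?thesis .
qed

text \<open>The summand \<open>1\<close> only serves to make \<open>M\<close> positive.\<close>

definition M :: real where "M = 1 + 2 * (\<Sum>x\<in>UNIV. \<bar>Q (indicator {x}) x\<bar>)"

lemma M_pos: "M > 0"
proof -
  have "0 \<le> (\<Sum>x\<in>UNIV. \<bar>Q (indicator {x}) x\<bar>)" by (rule sum_nonneg) simp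
  then show ?thesis unfolding M_def by linarith
qed

text \<open>Subtracting the constant \<open>Min (range f)\<close>, on which \<open>Q\<close>
  vanishes, makes \<open>Q_nonneg_ge\<close> applicable; \<open>M / 2\<close> dominates every
  diagonal entry. Measuring \<open>f x\<close> from the minimum is what keeps an Euler step above
  \<open>Min (range f)\<close>.\<close>

lemma Q_ge_Min: "- (M / 2 * (f x - Min (range f))) \<le> Q f x"
proof -
  define m where "m = Min (range f)"
  have m: "m \<le> f y" for y by (simp add: m_def)
  have "\<bar>Q (indicator {x}) x\<bar> \<le> (\<Sum>x\<in>UNIV. \<bar>Q (indicator {x}) x\<bar>)"
    by (rule member_le_sum) auto
  also have "\<dots> \<le> M / 2" by (simp add: M_def)
  finally have "- (M / 2) \<le> Q (indicator {x}) x" by (simp add: abs_le_iff)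
  then have "- (M / 2 * (f x - m)) \<le> (f x - m) * Q (indicator {x}) x"
    using m[of x] mult_left_mono[of "- (M / 2)" "Q (indicator {x}) x" "f x - m"]
    by (simp add: mult.commute)
  also have "\<dots> \<le> Q (\<lambda>z. f z - m) x"
    using Q_nonneg_ge[of "\<lambda>z. f z - m" x] m by simp
  also have "\<dots> \<le> Q f x"
    using Q_super[of "\<lambda>z. f z - m" x "\<lambda>_. m"] by (simp add: Q_const)
  finally show ?thesis by (simp add: m_def)
qed

lemma Q_Lipschitz: "max_norm (\<lambda>x. Q f x - Q g x) \<le> M * max_norm (\<lambda>x. f x - g x)"
proof (rule superadditive_Lipschitz)
  fix f :: "'x \<Rightarrow> real" and x
  \<comment> \<open>The factor 2 here is the one built into \<open>M\<close>; it cancels the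
    \<open>M / 2\<close> of \<open>Q_ge_Min\<close>.\<close>
  have "f x - Min (range f) \<le> 2 * max_norm f"
    using abs_le_max_norm[of f x] Min_range_ge_uminus_max_norm[of f] by linarith
  then have "M / 2 * (f x - Min (range f)) \<le> M / 2 * (2 * max_norm f)"
    using M_pos by (intro mult_left_mono) auto
  then show "- (M * max_norm f) \<le> Q f x" using Q_ge_Min[of f x] by simp
qed (rule Q_super)

lemma Q_norm_le: "max_norm (Q f) \<le> M * max_norm f"
  using Q_Lipschitz[of f "\<lambda>_. 0"] by (simp add: Q_const)

section \<open>Error estimates for Euler products\<close>

lemma step_lower_transition:
  assumes "0 \<le> d" "d * M \<le> 1"
  shows "lower_transition_operator (\<lambda>f x. f x + d * Q f x)"
  unfolding lower_transition_operator_def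
proof (intro conjI allI impI)
  fix f :: "'x \<Rightarrow> real" and x
  define e where "e = f x - Min (range f)"
  have e: "0 \<le> e" by (simp add: e_def)
  have "d * M / 2 * e \<le> 1 * e" using assms e by (intro mult_right_mono) auto
  moreover have "d * - (M / 2 * e) \<le> d * Q f x"
    using Q_ge_Min[of f x] assms unfolding e_def by (intro mult_left_mono) auto
  ultimately show "Min (range f) \<le> f x + d * Q f x" by (simp add: e_def[symmetric]) (simp add: e_def)
next
  fix f g x
  show "f x + d * Q f x + (g x + d * Q g x) \<le> f x + g x + d * Q (\<lambda>z. f z + g z) x"
    using mult_left_mono[OF Q_super[of f x g] assms(1)] by (simp add: algebra_simps)
qed (simp add: Q_scale algebra_simps)

text \<open>The range of steps in which \<open>step_lower_transition\<close> makes each factor a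
  lower transition operator, hence non-expansive.\<close>

definition small :: "real list \<Rightarrow> bool" where
  "small ds \<longleftrightarrow> (\<forall>d\<in>set ds. 0 \<le> d \<and> d * M \<le> 1)"

lemma euler_lower_transition:
  assumes "small ds" shows "lower_transition_operator (euler Q ds)"
  using assms
proof (induction ds)
  case Nil
  then show ?case by (simp add: lower_transition_operator_def)
next
  case (Cons d ds)
  then have "lower_transition_operator ((\<lambda>f x. f x + d * Q f x) \<circ> euler Q ds)"
    by (intro lower_transition_operator_comp step_lower_transition) (auto simp: small_def)
  moreover have "euler Q (d # ds) = (\<lambda>f x. f x + d * Q f x) \<circ> euler Q ds" by (simp add: fun_eq_iff)
  ultimately show ?case by (simp only:)
qed

lemma small_sum_nonneg: "small ds \<Longrightarrow> 0 \<le> sum_list ds"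
  by (auto simp: small_def intro!: sum_list_nonneg)

text \<open>A further step of length \<open>d\<close> adds \<open>d * Q g\<close> with
  \<open>max_norm g\<close> at most \<open>max_norm f\<close>, so it moves the result by at most
  \<open>d * M * max_norm f\<close>.\<close>

lemma euler_minus_id:
  assumes "small ds"
  shows "max_norm (\<lambda>x. euler Q ds f x - f x) \<le> M * sum_list ds * max_norm f"
  using assms
proof (induction ds)
  case (Cons d ds)
  have sm: "small ds" "0 \<le> d" using Cons.prems by (auto simp: small_def)
  define g where "g = euler Q ds f"
  have "max_norm (Q g) \<le> M * max_norm f"
    using Q_norm_le[of g] lower_transition_operator_norm_le[OF euler_lower_transition[OF sm(1)], of f] M_pos
    unfolding g_def by (meson mult_left_mono less_imp_le order_trans)
  then have "d * max_norm (Q g) \<le> d * (M * max_norm f)" using sm by (intro mult_left_mono)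
  moreover have "max_norm (\<lambda>x. (g x - f x) + d * Q g x) \<le> max_norm (\<lambda>x. g x - f x) + d * max_norm (Q g)"
    using max_norm_triangle[of "\<lambda>x. g x - f x" "\<lambda>x. d * Q g x"] sm by (simp add: max_norm_scale)
  ultimately show ?case using Cons.IH[OF sm(1)] by (simp add: g_def[symmetric] algebra_simps)
qed (simp add: max_norm_const)

text \<open>A further step \<open>d\<close> after total length \<open>D\<close> adds the error
  \<open>d * (Q g - Q f)\<close>. By the Lipschitz bound and \<open>euler_minus_id\<close> this is
  at most \<open>M\<^sup>2 * d * D * max_norm f\<close>, and
  \<open>D\<^sup>2 + d * D \<le> (d + D)\<^sup>2\<close> closes the induction.\<close>

lemma euler_one_step:
  assumes "small ds"
  shows "max_norm (\<lambda>x. euler Q ds f x - (f x + sum_list ds * Q f x))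
    \<le> M\<^sup>2 * (sum_list ds)\<^sup>2 * max_norm f"
  using assms
proof (induction ds)
  case (Cons d ds)
  have sm: "small ds" "0 \<le> d" using Cons.prems by (auto simp: small_def)
  define g where "g = euler Q ds f"
  define D where "D = sum_list ds"
  have D: "0 \<le> D" using small_sum_nonneg[OF sm(1)] by (simp add: D_def)
  have "max_norm (\<lambda>x. Q g x - Q f x) \<le> M * (M * D * max_norm f)"
    using Q_Lipschitz[of g f] euler_minus_id[OF sm(1), of f] M_pos
    unfolding g_def D_def by (meson mult_left_mono less_imp_le order_trans)
  then have "d * max_norm (\<lambda>x. Q g x - Q f x) \<le> d * (M * (M * D * max_norm f))"
    using sm by (intro mult_left_mono)
  moreover have "max_norm (\<lambda>x. (g x - (f x + D * Q f x)) + d * (Q g x - Q f x))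
      \<le> max_norm (\<lambda>x. g x - (f x + D * Q f x)) + d * max_norm (\<lambda>x. Q g x - Q f x)"
    using max_norm_triangle[of "\<lambda>x. g x - (f x + D * Q f x)" "\<lambda>x. d * (Q g x - Q f x)"] sm
    by (simp add: max_norm_scale)
  ultimately have "max_norm (\<lambda>x. (g x - (f x + D * Q f x)) + d * (Q g x - Q f x))
      \<le> M\<^sup>2 * max_norm f * (D\<^sup>2 + d * D)"
    using Cons.IH[OF sm(1)] by (simp add: g_def[symmetric] D_def[symmetric] algebra_simps power2_eq_square)
  also have "\<dots> \<le> M\<^sup>2 * max_norm f * (d + D)\<^sup>2"
    using sm D max_norm_nonneg[of f]
    by (intro mult_left_mono mult_nonneg_nonneg) (auto simp: power2_sum)
  finally show ?case by (simp add: g_def[symmetric] D_def[symmetric] algebra_simps)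
qed (simp add: max_norm_const)

text \<open>Each block is replaced by a single step of its length \<beta>. One replacement costs a
  multiple \<open>M\<^sup>2 * \<beta>\<^sup>2 \<le> M\<^sup>2 * \<sigma> * \<beta>\<close> of the
  norm, and these costs add up linearly in the total length.\<close>

lemma euler_concat:
  assumes "\<forall>b\<in>set bs. small b" "small (map sum_list bs)" "\<forall>b\<in>set bs. sum_list b \<le> \<sigma>"
  shows "max_norm (\<lambda>x. euler Q (concat bs) f x - euler Q (map sum_list bs) f x)
    \<le> M\<^sup>2 * \<sigma> * sum_list (concat bs) * max_norm f"
  using assms
proof (induction bs)
  case (Cons b bs)
  define g where "g = euler Q (concat bs) f"
  define h where "h = euler Q (map sum_list bs) f"
  define \<beta> where "\<beta> = sum_list b"
  have b: "small b" "0 \<le> \<beta>" "\<beta> \<le> \<sigma>" "\<beta> * M \<le> 1" "small (concat bs)"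
    using Cons.prems small_sum_nonneg[of b] by (auto simp: \<beta>_def small_def)
  have "max_norm (\<lambda>x. euler Q b g x - (g x + \<beta> * Q g x)) \<le> M\<^sup>2 * \<beta>\<^sup>2 * max_norm g"
    using euler_one_step[OF b(1)] by (simp add: \<beta>_def)
  also have "\<dots> \<le> M\<^sup>2 * (\<sigma> * \<beta>) * max_norm f"
    using b lower_transition_operator_norm_le[OF euler_lower_transition[OF b(5)], of f]
    by (intro mult_mono mult_left_mono)
      (auto simp: g_def power2_eq_square max_norm_nonneg mult_right_mono)
  finally have 1: "max_norm (\<lambda>x. euler Q b g x - (g x + \<beta> * Q g x)) \<le> M\<^sup>2 * (\<sigma> * \<beta>) * max_norm f" .
  \<comment> \<open>The error made in the later blocks passes through this step without
    growing.\<close>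
  have 2: "max_norm (\<lambda>x. (g x + \<beta> * Q g x) - (h x + \<beta> * Q h x)) \<le> max_norm (\<lambda>x. g x - h x)"
    using lower_transition_operator_nonexpansive[OF step_lower_transition[OF b(2,4)]] .
  have 3: "max_norm (\<lambda>x. g x - h x) \<le> M\<^sup>2 * \<sigma> * sum_list (concat bs) * max_norm f"
    unfolding g_def h_def by (rule Cons.IH) (use Cons.prems in \<open>auto simp: small_def\<close>)
  have "max_norm (\<lambda>x. euler Q b g x - (h x + \<beta> * Q h x))
      \<le> M\<^sup>2 * (\<sigma> * \<beta>) * max_norm f + M\<^sup>2 * \<sigma> * sum_list (concat bs) * max_norm f"
    using 1 2 3 max_norm_diff_triangle[of "euler Q b g" "\<lambda>x. h x + \<beta> * Q h x" "\<lambda>x. g x + \<beta> * Q g x"]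
    by linarith
  then show ?case
    by (simp add: euler_append g_def[symmetric] h_def[symmetric] \<beta>_def[symmetric] algebra_simps)
qed (simp add: max_norm_const)

text \<open>Both products are compared with the product over a common refinement; the factor 2
  counts the two comparisons.\<close>

lemma euler_compare:
  assumes ds: "\<forall>d\<in>set ds. 0 \<le> d \<and> d \<le> \<sigma>" and es: "\<forall>e\<in>set es. 0 \<le> e \<and> e \<le> \<sigma>"
    and sum: "sum_list ds = sum_list es" and small: "\<sigma> * M \<le> 1"
  shows "max_norm (\<lambda>x. euler Q ds f x - euler Q es f x) \<le> 2 * M\<^sup>2 * \<sigma> * sum_list ds * max_norm f"
proof -
  define ds' es' where "ds' = filter (\<lambda>d. 0 < d) ds" and "es' = filter (\<lambda>d. 0 < d) es"
  have eqs: "euler Q ds' f = euler Q ds f" "euler Q es' f = euler Q es f"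
      "sum_list ds' = sum_list ds" "sum_list es' = sum_list es"
    using ds es by (simp_all add: ds'_def es'_def euler_filter_pos sum_list_filter_pos)
  obtain bs cs where r: "concat bs = concat cs" "map sum_list bs = ds'" "map sum_list cs = es'"
      "\<forall>b\<in>set bs. \<forall>d\<in>set b. 0 < d"
  proof -
    have "\<forall>d\<in>set ds'. 0 < d" "\<forall>e\<in>set es'. 0 < e" "sum_list ds' = sum_list es'"
      unfolding eqs by (simp_all add: ds'_def es'_def sum)
    from common_refinement[OF this] show thesis using that by metis
  qed
  have mesh: "d * M \<le> 1" if "d \<le> \<sigma>" for d
    using order_trans[OF mult_right_mono[OF that] small] M_pos by simp
  have block: "max_norm (\<lambda>x. euler Q (concat as) f x - euler Q (map sum_list as) f x)
      \<le> M\<^sup>2 * \<sigma> * sum_list (concat as) * max_norm f"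
    if pos: "\<forall>a\<in>set as. \<forall>d\<in>set a. 0 < d" and le: "\<forall>d\<in>set (map sum_list as). d \<le> \<sigma>" for as
  proof (rule euler_concat)
    have "d \<le> sum_list a" if "a \<in> set as" "d \<in> set a" for a d
      using that pos by (intro member_le_sum_list_real) (auto intro: less_imp_le)
    then have "d \<le> \<sigma>" if "a \<in> set as" "d \<in> set a" for a d
      using that le by (metis (no_types) imageI list.set_map order_trans)
    with pos mesh show "\<forall>a\<in>set as. small a"
      unfolding small_def by (meson less_imp_le)
    have "0 \<le> sum_list a" if "a \<in> set as" for a
      using that pos by (meson sum_list_nonneg less_imp_le)
    with le mesh show "small (map sum_list as)"
      unfolding small_def by auto
  qed (use le in auto)
  have "set (concat bs) = set (concat cs)" by (simp add: r)
  then have "\<forall>b\<in>set cs. \<forall>d\<in>set b. 0 < d" using r(4) by auto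
  moreover have "\<forall>d\<in>set ds'. d \<le> \<sigma>" "\<forall>d\<in>set es'. d \<le> \<sigma>"
    using ds es by (auto simp: ds'_def es'_def)
  ultimately have 1: "max_norm (\<lambda>x. euler Q (concat bs) f x - euler Q ds f x)
        \<le> M\<^sup>2 * \<sigma> * sum_list (concat bs) * max_norm f"
      "max_norm (\<lambda>x. euler Q (concat bs) f x - euler Q es f x)
        \<le> M\<^sup>2 * \<sigma> * sum_list (concat bs) * max_norm f"
    using block[of bs, unfolded r(2)] block[of cs, unfolded r(3) r(1)[symmetric]] r(4)
    unfolding eqs by blast+
  have "sum_list (concat as) = sum_list (map sum_list as)" for as :: "real list list"
    by (induction as) simp_all
  from this[of bs] have "sum_list (concat bs) = sum_list ds" by (simp only: r(2) eqs)
  then show ?thesis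
    using 1 max_norm_diff_triangle[of "euler Q ds f" "euler Q es f" "euler Q (concat bs) f"]
      max_norm_minus_commute[of "euler Q ds f"] by simp
qed

section \<open>The limit semigroup\<close>

text \<open>The limit is taken pointwise along uniform step lists; \<open>Suc n\<close> avoids
  division by zero. \<open>T_convergent\<close> shows that the limit exists for non-negative
  \<tau>.\<close>

definition T :: "real \<Rightarrow> 'x operator" where
  "T \<tau> f x = lim (\<lambda>n. euler Q (replicate (Suc n) (\<tau> / Suc n)) f x)"

lemma mesh_bound_exists:
  assumes "0 < e" "0 \<le> C"
  obtains \<sigma> where "0 < \<sigma>" "\<sigma> * M \<le> 1" "\<sigma> * C \<le> e"
proof
  \<comment> \<open>The denominator \<open>C + 1\<close> stays positive when
    \<open>C = 0\<close>.\<close>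
  define \<sigma> where "\<sigma> = min (1 / M) (e / (C + 1))"
  show "0 < \<sigma>" using assms M_pos by (simp add: \<sigma>_def)
  have "\<sigma> * M \<le> 1 / M * M" using M_pos by (intro mult_right_mono) (auto simp: \<sigma>_def)
  then show "\<sigma> * M \<le> 1" using M_pos by simp
  have "\<sigma> * C \<le> \<sigma> * (C + 1)" using \<open>0 < \<sigma>\<close> by (intro mult_left_mono) auto
  also have "\<dots> \<le> e / (C + 1) * (C + 1)" using assms by (intro mult_right_mono) (auto simp: \<sigma>_def)
  finally show "\<sigma> * C \<le> e" using assms by simp
qed

lemma uniform_small:
  assumes "0 < \<sigma>"
  shows "\<forall>\<^sub>F n in sequentially. \<tau> / Suc n \<le> \<sigma>"
proof -
  have "(\<lambda>n. \<tau> / Suc n) \<longlonglongrightarrow> 0" using LIMSEQ_Suc[OF lim_const_over_n[of \<tau>]] by simp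
  then show ?thesis using assms by (auto dest!: order_tendstoD(2) elim: eventually_mono)
qed

lemma sum_list_uniform: "sum_list (replicate (Suc n) (\<tau> / Suc n)) = (\<tau>::real)"
  by (simp add: sum_list_replicate del: replicate_Suc of_nat_Suc)

lemma T_convergent:
  assumes "0 \<le> \<tau>"
  shows "(\<lambda>n. euler Q (replicate (Suc n) (\<tau> / Suc n)) f x) \<longlonglongrightarrow> T \<tau> f x"
proof -
  let ?X = "\<lambda>n. euler Q (replicate (Suc n) (\<tau> / Suc n)) f x"
  have "Cauchy ?X"
  proof (rule CauchyI)
    fix e :: real assume e: "0 < e"
    \<comment> \<open>Half of \<open>e\<close> leaves room for the strict inequality in the Cauchy
      criterion.\<close>
    obtain \<sigma> where \<sigma>: "0 < \<sigma>" "\<sigma> * M \<le> 1" "\<sigma> * (2 * M\<^sup>2 * \<tau> * max_norm f) \<le> e / 2"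
      using mesh_bound_exists[of "e / 2" "2 * M\<^sup>2 * \<tau> * max_norm f"] assms e max_norm_nonneg[of f]
      by auto
    obtain N where N: "\<And>n. n \<ge> N \<Longrightarrow> \<tau> / Suc n \<le> \<sigma>"
      using uniform_small[OF \<sigma>(1), of \<tau>] unfolding eventually_sequentially by blast
    show "\<exists>N. \<forall>m\<ge>N. \<forall>n\<ge>N. norm (?X m - ?X n) < e"
    proof (intro exI[of _ N] allI impI)
      fix m n assume mn: "N \<le> m" "N \<le> n"
      have "norm (?X m - ?X n) \<le> max_norm (\<lambda>x. euler Q (replicate (Suc m) (\<tau> / Suc m)) f x
          - euler Q (replicate (Suc n) (\<tau> / Suc n)) f x)"
        unfolding real_norm_def by (rule abs_le_max_norm)
      also have "\<dots> \<le> 2 * M\<^sup>2 * \<sigma> * \<tau> * max_norm f"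
        using euler_compare[of "replicate (Suc m) (\<tau> / Suc m)" \<sigma> "replicate (Suc n) (\<tau> / Suc n)" f,
            unfolded sum_list_uniform] mn N \<sigma> assms by (auto simp del: replicate_Suc of_nat_Suc)
      also have "\<dots> < e" using \<sigma>(3) e by (simp add: mult.commute mult.left_commute)
      finally show "norm (?X m - ?X n) < e" .
    qed
  qed
  then have "convergent ?X" by (rule Cauchy_convergent)
  then show ?thesis unfolding T_def by (simp only: convergent_LIMSEQ_iff)
qed

text \<open>Compare \<open>ds\<close> with uniform lists of the same total length: once their step
  is at most \<sigma>, the bound of \<open>euler_compare\<close> no longer depends on
  \<open>n\<close> and survives the limit.\<close>

lemma T_approx:
  assumes ds: "\<forall>d\<in>set ds. 0 \<le> d \<and> d \<le> \<sigma>" and \<sigma>: "0 < \<sigma>" "\<sigma> * M \<le> 1"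
  shows "max_norm (\<lambda>x. T (sum_list ds) f x - euler Q ds f x) \<le> 2 * M\<^sup>2 * \<sigma> * sum_list ds * max_norm f"
  unfolding max_norm_le_iff
proof
  fix x
  define \<tau> where "\<tau> = sum_list ds"
  have \<tau>: "0 \<le> \<tau>" using ds by (auto simp: \<tau>_def intro!: sum_list_nonneg)
  let ?X = "\<lambda>n. euler Q (replicate (Suc n) (\<tau> / Suc n)) f"
  have "\<forall>\<^sub>F n in sequentially. \<bar>?X n x - euler Q ds f x\<bar> \<le> 2 * M\<^sup>2 * \<sigma> * \<tau> * max_norm f"
    using uniform_small[OF \<sigma>(1), of \<tau>]
  proof eventually_elim
    case (elim n)
    have "max_norm (\<lambda>x. ?X n x - euler Q ds f x) \<le> 2 * M\<^sup>2 * \<sigma> * \<tau> * max_norm f"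
      using euler_compare[of "replicate (Suc n) (\<tau> / Suc n)" \<sigma> ds f, unfolded sum_list_uniform] elim \<tau> ds \<sigma>
      by (auto simp: \<tau>_def simp del: replicate_Suc of_nat_Suc)
    then show ?case unfolding max_norm_le_iff by blast
  qed
  moreover have "(\<lambda>n. \<bar>?X n x - euler Q ds f x\<bar>) \<longlonglongrightarrow> \<bar>T \<tau> f x - euler Q ds f x\<bar>"
    by (intro tendsto_intros T_convergent \<tau>)
  ultimately show "\<bar>T (sum_list ds) f x - euler Q ds f x\<bar> \<le> 2 * M\<^sup>2 * \<sigma> * sum_list ds * max_norm f"
    unfolding \<tau>_def[symmetric] by (intro tendsto_upperbound) auto
qed

lemma uniform_lower_transition:
  assumes "0 \<le> \<tau>"
  shows "\<forall>\<^sub>F n in sequentially. lower_transition_operator (euler Q (replicate (Suc n) (\<tau> / Suc n)))"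
proof -
  have "0 < 1 / M" using M_pos by simp
  from uniform_small[OF this, of \<tau>] show ?thesis
  proof eventually_elim
    case (elim n)
    then have "\<tau> / Suc n * M \<le> 1" using M_pos by (simp add: pos_le_divide_eq del: of_nat_Suc)
    then show ?case
      using assms by (intro euler_lower_transition) (auto simp: small_def simp del: of_nat_Suc)
  qed
qed

text \<open>The approximating products are lower transition operators for all large
  \<open>n\<close>, and the defining conditions pass to pointwise limits.\<close>

lemma T_lower_transition:
  assumes "0 \<le> \<tau>" shows "lower_transition_operator (T \<tau>)"
  unfolding lower_transition_operator_def
proof (intro conjI allI impI)
  note ev = eventually_mono[OF uniform_lower_transition[OF assms]]
  note lim = T_convergent[OF assms]
  fix f g :: "'x \<Rightarrow> real" and c x
  show "Min (range f) \<le> T \<tau> f x"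
    by (rule tendsto_lowerbound[OF lim]) (rule ev, erule lower_transition_operatorD(1), simp)
  show "T \<tau> f x + T \<tau> g x \<le> T \<tau> (\<lambda>z. f z + g z) x"
    by (rule tendsto_le[OF _ lim tendsto_add[OF lim lim]])
      (simp, rule ev, erule lower_transition_operatorD(2))
  show "T \<tau> (\<lambda>z. c * f z) x = c * T \<tau> f x" if "0 \<le> c"
  proof (rule LIMSEQ_unique[OF lim])
    show "(\<lambda>n. euler Q (replicate (Suc n) (\<tau> / Suc n)) (\<lambda>z. c * f z) x) \<longlonglongrightarrow> c * T \<tau> f x"
      by (rule Lim_transform_eventually[OF tendsto_mult_left[OF lim]])
        (rule ev, erule lower_transition_operatorD(3)[symmetric], rule that)
  qed
qed

text \<open>Euler products over concatenated lists factor exactly. Three errors of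
  \<open>e / 3\<close> remain: replacing \<open>T (a + b)\<close>, replacing \<open>T a\<close> at
  \<open>euler Q B f\<close>, and replacing \<open>T b\<close>, the last one carried through the
  non-expansive \<open>T a\<close>.\<close>

lemma T_semigroup:
  assumes ab: "0 \<le> a" "0 \<le> b"
  shows "T (a + b) f = T a (T b f)"
proof
  fix x
  have le: "\<bar>T (a + b) f x - T a (T b f) x\<bar> \<le> e" if e: "0 < e" for e
  proof -
    define C where "C = 2 * M\<^sup>2 * (a + b) * max_norm f"
    have C: "0 \<le> C" using ab max_norm_nonneg[of f] by (simp add: C_def)
    obtain \<sigma> where \<sigma>: "0 < \<sigma>" "\<sigma> * M \<le> 1" "\<sigma> * C \<le> e / 3"
      using mesh_bound_exists[of "e / 3" C] C e by auto
    obtain n where n: "a / Suc n \<le> \<sigma>" "b / Suc n \<le> \<sigma>"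
      using eventually_happens[OF eventually_conj[OF uniform_small[OF \<sigma>(1), of a] uniform_small[OF \<sigma>(1), of b]]]
      by auto
    define A B where "A = replicate (Suc n) (a / Suc n)" and "B = replicate (Suc n) (b / Suc n)"
    have AB: "sum_list A = a" "sum_list B = b"
        "\<forall>d\<in>set A. 0 \<le> d \<and> d \<le> \<sigma>" "\<forall>d\<in>set B. 0 \<le> d \<and> d \<le> \<sigma>"
      using n ab unfolding A_def B_def sum_list_uniform by (auto simp del: replicate_Suc of_nat_Suc)
    \<comment> \<open>Uniformity in \<open>k\<close> allows the use of this bound at
      \<open>k = euler Q B f\<close> as well as at \<open>f\<close>.\<close>
    have approx: "max_norm (\<lambda>x. T (sum_list ds) k x - euler Q ds k x) \<le> e / 3"
      if ds: "\<forall>d\<in>set ds. 0 \<le> d \<and> d \<le> \<sigma>" "sum_list ds \<le> a + b" and k: "max_norm k \<le> max_norm f"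
      for ds k
    proof -
      have "max_norm (\<lambda>x. T (sum_list ds) k x - euler Q ds k x) \<le> 2 * M\<^sup>2 * \<sigma> * sum_list ds * max_norm k"
        using ds(1) \<sigma>(1,2) by (rule T_approx)
      also have "\<dots> \<le> 2 * M\<^sup>2 * \<sigma> * (a + b) * max_norm f"
        using ds(2) k \<sigma>(1) ab max_norm_nonneg[of k] by (intro mult_mono mult_left_mono) auto
      also have "\<dots> = \<sigma> * C" by (simp add: C_def)
      also note \<sigma>(3)
      finally show ?thesis .
    qed
    have "d * M \<le> 1" if "d \<le> \<sigma>" for d
      using order_trans[OF mult_right_mono[OF that] \<sigma>(2)] M_pos by simp
    with AB(4) have "small B" unfolding small_def by blast
    then have nB: "max_norm (euler Q B f) \<le> max_norm f"
      by (rule lower_transition_operator_norm_le[OF euler_lower_transition])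
    have "\<forall>d\<in>set (A @ B). 0 \<le> d \<and> d \<le> \<sigma>" using AB(3,4) by auto
    from approx[OF this, of f] have 1: "max_norm (\<lambda>x. T (a + b) f x - euler Q A (euler Q B f) x) \<le> e / 3"
      by (simp add: AB(1,2) euler_append)
    from approx[OF AB(3) _ nB] have 2: "max_norm (\<lambda>x. T a (euler Q B f) x - euler Q A (euler Q B f) x) \<le> e / 3"
      using ab by (simp add: AB(1))
    from approx[OF AB(4), of f] have "max_norm (\<lambda>x. T b f x - euler Q B f x) \<le> e / 3"
      using ab by (simp add: AB(2))
    then have 3: "max_norm (\<lambda>x. T a (T b f) x - T a (euler Q B f) x) \<le> e / 3"
      by (rule order_trans[OF lower_transition_operator_nonexpansive[OF T_lower_transition[OF ab(1)]]])
    have "\<bar>T (a + b) f x - euler Q A (euler Q B f) x\<bar> \<le> e / 3"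
      "\<bar>T a (euler Q B f) x - euler Q A (euler Q B f) x\<bar> \<le> e / 3"
      "\<bar>T a (T b f) x - T a (euler Q B f) x\<bar> \<le> e / 3"
      using 1 2 3 unfolding max_norm_le_iff by blast+
    then show ?thesis by linarith
  qed
  have "\<bar>T (a + b) f x - T a (T b f) x\<bar> \<le> 0"
    by (rule field_le_epsilon) (simp add: le)
  then show "T (a + b) f x = T a (T b f) x" by simp
qed

section \<open>Difference quotients of the semigroup\<close>

text \<open>For the one-element list \<open>[h]\<close> both the mesh bound and the total length are
  \<open>h\<close>, so \<open>T_approx\<close> is quadratic in \<open>h\<close>.\<close>

lemma T_one_step:
  assumes "0 < h" "h * M \<le> 1"
  shows "max_norm (\<lambda>x. T h f x - (f x + h * Q f x)) \<le> 2 * M\<^sup>2 * h\<^sup>2 * max_norm f"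
proof -
  have "max_norm (\<lambda>x. T (sum_list [h]) f x - euler Q [h] f x) \<le> 2 * M\<^sup>2 * h * sum_list [h] * max_norm f"
    by (rule T_approx) (use assms in auto)
  then show ?thesis by (simp add: power2_eq_square)
qed

text \<open>With \<open>g\<close> the value at the earlier of the two times, the quotient is
  \<open>(T k g - g) / k\<close> for either sign of \<open>h\<close>, and \<open>T_one_step\<close>
  puts it within \<open>2 * M\<^sup>2 * k * max_norm f\<close> of \<open>Q g\<close>. For negative
  \<open>h\<close> the derivative is taken at the later point, and moving from \<open>Q g\<close> to
  \<open>Q (T k g)\<close> costs another \<open>3 * M\<^sup>2 * k * max_norm f\<close>.\<close>

lemma T_difference_quotient:
  assumes a: "0 \<le> a" "0 \<le> a + h" and h: "h \<noteq> 0" "\<bar>h\<bar> * M \<le> 1"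
  shows "max_norm (\<lambda>x. (T (a + h) f x - T a f x) / h - Q (T a f) x) \<le> 5 * M\<^sup>2 * \<bar>h\<bar> * max_norm f"
proof -
  define k where "k = \<bar>h\<bar>"
  define g where "g = T (min a (a + h)) f"
  have k: "0 < k" "k * M \<le> 1" using h by (auto simp: k_def)
  have g: "max_norm g \<le> max_norm f"
    unfolding g_def using a by (intro lower_transition_operator_norm_le T_lower_transition) auto
  have Tk: "T (max a (a + h)) f = T k g"
    unfolding g_def using a T_semigroup[of k "min a (a + h)" f]
    by (auto simp: k_def min_def max_def abs_if add.commute split: if_splits)
  have "max_norm (\<lambda>x. (T k g x - g x) / k - Q g x) = max_norm (\<lambda>x. (1 / k) * (T k g x - (g x + k * Q g x)))"
    using k by (intro arg_cong[where f=max_norm] ext) (simp add: field_simps)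
  also have "\<dots> = (1 / k) * max_norm (\<lambda>x. T k g x - (g x + k * Q g x))"
    unfolding max_norm_scale using k by simp
  also have "\<dots> \<le> (1 / k) * (2 * M\<^sup>2 * k\<^sup>2 * max_norm f)"
  proof (rule mult_left_mono)
    show "max_norm (\<lambda>x. T k g x - (g x + k * Q g x)) \<le> 2 * M\<^sup>2 * k\<^sup>2 * max_norm f"
      using T_one_step[OF k, of g] mult_left_mono[OF g, of "2 * M\<^sup>2 * k\<^sup>2"] by simp
  qed (use k in simp)
  also have "\<dots> = 2 * M\<^sup>2 * k * max_norm f" using k by (simp add: power2_eq_square)
  finally have 1: "max_norm (\<lambda>x. (T k g x - g x) / k - Q g x) \<le> 2 * M\<^sup>2 * k * max_norm f" .
  show ?thesis
  proof (cases "h > 0")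
    case True
    then have "T a f = g" "T (a + h) f = T k g" "k = h"
      using Tk by (auto simp: g_def k_def min_def max_def)
    moreover have "2 * M\<^sup>2 * k * max_norm f \<le> 5 * M\<^sup>2 * k * max_norm f"
      using k max_norm_nonneg[of f] by (intro mult_right_mono) auto
    ultimately show ?thesis using 1 True order_trans by fastforce
  next
    case False
    then have eq: "T a f = T k g" "T (a + h) f = g" "h = - k" "\<bar>h\<bar> = k"
      using Tk by (auto simp: g_def k_def min_def max_def)
    \<comment> \<open>The 3 is 2 + 1: the one-step error, made linear in \<open>k\<close> by
      \<open>k * M \<le> 1\<close>, and the size of \<open>k * Q g\<close>.\<close>
    have "max_norm (\<lambda>x. g x - T k g x) \<le> 3 * M * k * max_norm f"
    proof -
      have "max_norm (\<lambda>x. T k g x - g x)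
          = max_norm (\<lambda>x. (T k g x - (g x + k * Q g x)) + k * Q g x)" by simp
      also have "\<dots> \<le> max_norm (\<lambda>x. T k g x - (g x + k * Q g x)) + max_norm (\<lambda>x. k * Q g x)"
        by (rule max_norm_triangle)
      also have "max_norm (\<lambda>x. k * Q g x) = k * max_norm (Q g)"
        using k by (simp add: max_norm_scale)
      also have "max_norm (\<lambda>x. T k g x - (g x + k * Q g x)) \<le> 2 * M\<^sup>2 * k\<^sup>2 * max_norm g"
        by (rule T_one_step[OF k])
      also have "2 * M\<^sup>2 * k\<^sup>2 * max_norm g = (k * M) * (2 * M * k * max_norm g)"
        by (simp add: power2_eq_square)
      also have "\<dots> \<le> 1 * (2 * M * k * max_norm g)"
        using k M_pos max_norm_nonneg[of g] by (intro mult_right_mono) auto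
      also have "k * max_norm (Q g) \<le> k * (M * max_norm g)"
        using k Q_norm_le[of g] by (intro mult_left_mono) auto
      also have "1 * (2 * M * k * max_norm g) + k * (M * max_norm g) = 3 * M * k * max_norm g"
        by simp
      also have "\<dots> \<le> 3 * M * k * max_norm f"
        using g k M_pos by (intro mult_left_mono) auto
      finally show ?thesis using max_norm_minus_commute[of g "T k g"] by simp
    qed
    then have "M * max_norm (\<lambda>x. g x - T k g x) \<le> M * (3 * M * k * max_norm f)"
      using M_pos by (intro mult_left_mono) auto
    then have 2: "max_norm (\<lambda>x. Q g x - Q (T k g) x) \<le> 3 * M\<^sup>2 * k * max_norm f"
      using Q_Lipschitz[of g "T k g"] by (simp add: power2_eq_square mult.assoc mult.left_commute)
    have "(T (a + h) f x - T a f x) / h = (T k g x - g x) / k" for x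
      unfolding eq(1,2) unfolding eq(3) by (simp add: minus_divide_left)
    then show ?thesis
      using 1 2 max_norm_diff_triangle[of "\<lambda>x. (T k g x - g x) / k" "Q (T k g)" "Q g"]
      by (simp add: eq(1,4))
  qed
qed

end

section \<open>Subdivisions and the identification of \<open>L\<close>\<close>

lemma steps_props:
  assumes "u \<in> subdivisions t s"
  shows "sum_list (steps u) = s - t" "\<forall>d\<in>set (steps u). 0 \<le> d \<and> d \<le> mesh u"
proof -
  have u: "u \<noteq> []" "sorted_wrt (<) u" "hd u = t" "last u = s"
    using assms by (auto simp: subdivisions_def)
  define n where "n = length u - 1"
  have len: "length u = Suc n" using u by (simp add: n_def)
  have "steps u = map (\<lambda>i. u ! Suc i - u ! i) [0..<n]"
    unfolding steps_def len by (rule nth_equalityI) (simp_all add: nth_append del: upt_Suc)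
  then have "sum_list (steps u) = (\<Sum>i<n. u ! Suc i - u ! i)"
    by (simp add: interv_sum_list_conv_sum_set_nat atLeast0LessThan)
  also have "\<dots> = u ! n - u ! 0" by (rule sum_lessThan_telescope)
  finally show "sum_list (steps u) = s - t" using u len by (simp add: hd_conv_nth last_conv_nth)
  have "0 \<le> d" if "d \<in> set (steps u)" for d
    using that u(2) by (auto simp: steps_def sorted_wrt_iff_nth_less intro!: less_imp_le)
  then show "\<forall>d\<in>set (steps u). 0 \<le> d \<and> d \<le> mesh u" by (auto simp: mesh_def intro!: Max_ge)
qed

text \<open>Ensures that the convergence condition in \<open>L\<close> is never vacuous, so that it
  can determine the operator.\<close>

lemma fine_subdivision_exists:
  assumes "t \<le> s" "0 < \<delta>"
  shows "\<exists>u\<in>subdivisions t s. mesh u \<le> \<delta>"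
proof (cases "t = s")
  case True
  then show ?thesis
    using assms by (intro bexI[of _ "[t]"]) (auto simp: subdivisions_def mesh_def steps_def)
next
  case False
  obtain n where n: "(s - t) / \<delta> < real (Suc n)"
    by (metis reals_Archimedean2 less_trans lessI of_nat_less_iff)
  define h where "h = (s - t) / Suc n"
  have h: "0 < h" "h \<le> \<delta>" "real (Suc n) * h = s - t"
    using False assms n by (simp_all add: h_def pos_divide_le_eq pos_divide_less_eq mult.commute less_imp_le del: of_nat_Suc)
  \<comment> \<open>There are \<open>Suc (Suc n)\<close> points for \<open>Suc n\<close> steps of
    length \<open>h\<close>, so the last point is \<open>s\<close>.\<close>
  define u where "u = map (\<lambda>i. t + real i * h) [0..<Suc (Suc n)]"
  have "u \<in> subdivisions t s"
    using h unfolding subdivisions_def u_def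
    by (auto simp: sorted_wrt_iff_nth_less hd_conv_nth last_conv_nth simp del: upt_Suc of_nat_Suc)
  moreover have "d = h" if "d \<in> set (steps u)" for d
    using that by (auto simp: steps_def u_def of_nat_diff algebra_simps simp del: upt_Suc)
  then have "mesh u \<le> \<delta>" using h assms unfolding mesh_def by (subst Max_le_iff) auto
  ultimately show ?thesis by blast
qed

context lower_rate
begin

text \<open>On functions of norm 1 the bound of \<open>T_approx\<close> no longer involves
  \<open>f\<close>, so pointwise approximation becomes approximation in operator norm.\<close>

lemma T_Phi_converge:
  assumes "t \<le> s" "0 < \<epsilon>"
  shows "\<exists>\<delta>>0. \<forall>u\<in>subdivisions t s. mesh u \<le> \<delta> \<longrightarrow>
    op_norm (\<lambda>f x. T (s - t) f x - Phi Q u f x) \<le> ereal \<epsilon>"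
proof -
  obtain \<delta> where \<delta>: "0 < \<delta>" "\<delta> * M \<le> 1" "\<delta> * (2 * M\<^sup>2 * (s - t)) \<le> \<epsilon>"
    using mesh_bound_exists[of \<epsilon> "2 * M\<^sup>2 * (s - t)"] assms by auto
  have "op_norm (\<lambda>f x. T (s - t) f x - Phi Q u f x) \<le> ereal \<epsilon>"
    if u: "u \<in> subdivisions t s" "mesh u \<le> \<delta>" for u
  proof (rule op_norm_le)
    fix f :: "'x \<Rightarrow> real" assume f: "max_norm f = 1"
    have "\<forall>d\<in>set (steps u). 0 \<le> d \<and> d \<le> \<delta>" using steps_props(2)[OF u(1)] u(2) by auto
    then have "max_norm (\<lambda>x. T (s - t) f x - Phi Q u f x) \<le> 2 * M\<^sup>2 * \<delta> * (s - t)"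
      using T_approx[of "steps u" \<delta> f] \<delta> f by (simp add: steps_props(1)[OF u(1)] Phi_eq_euler)
    also have "\<dots> = \<delta> * (2 * M\<^sup>2 * (s - t))" by simp
    finally show "max_norm (\<lambda>x. T (s - t) f x - Phi Q u f x) \<le> \<epsilon>" using \<delta> by simp
  qed
  with \<delta>(1) show ?thesis by blast
qed

text \<open>Existence is \<open>T_Phi_converge\<close>. For uniqueness, any candidate and
  \<open>T (s - t)\<close> are both within \<open>e / 2\<close> of \<open>Phi Q u\<close> for one
  sufficiently fine \<open>u\<close>, hence agree on functions of norm 1.\<close>

lemma L_eq_T:
  assumes "t \<le> s" shows "L Q t s = T (s - t)"
  unfolding L_def
proof (rule the_equality)
  show "lower_transition_operator (T (s - t)) \<and> (\<forall>\<epsilon>>0. \<exists>\<delta>>0. \<forall>u\<in>subdivisions t s. mesh u \<le> \<delta> \<longrightarrow>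
      op_norm (\<lambda>f x. T (s - t) f x - Phi Q u f x) \<le> ereal \<epsilon>)"
    using T_lower_transition T_Phi_converge assms by simp
next
  fix S
  assume S: "lower_transition_operator S \<and> (\<forall>\<epsilon>>0. \<exists>\<delta>>0. \<forall>u\<in>subdivisions t s. mesh u \<le> \<delta> \<longrightarrow>
      op_norm (\<lambda>f x. S f x - Phi Q u f x) \<le> ereal \<epsilon>)"
  show "S = T (s - t)"
  proof (rule lower_transition_operator_eqI)
    fix f :: "'x \<Rightarrow> real" assume f: "max_norm f = 1"
    have "max_norm (\<lambda>x. S f x - T (s - t) f x) \<le> 0 + e" if e: "0 < e" for e
    proof -
      from e have e2: "0 < e / 2" by simp
      obtain \<delta>1 where 1: "\<delta>1 > 0" "\<And>u. u \<in> subdivisions t s \<Longrightarrow> mesh u \<le> \<delta>1 \<Longrightarrow>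
          op_norm (\<lambda>f x. S f x - Phi Q u f x) \<le> ereal (e / 2)" using S e2 by blast
      obtain \<delta>2 where 2: "\<delta>2 > 0" "\<And>u. u \<in> subdivisions t s \<Longrightarrow> mesh u \<le> \<delta>2 \<Longrightarrow>
          op_norm (\<lambda>f x. T (s - t) f x - Phi Q u f x) \<le> ereal (e / 2)"
        using T_Phi_converge[OF assms e2] by blast
      obtain u where u: "u \<in> subdivisions t s" "mesh u \<le> min \<delta>1 \<delta>2"
        using fine_subdivision_exists[OF assms, of "min \<delta>1 \<delta>2"] 1 2 by auto
      have "ereal (max_norm (\<lambda>x. S f x - Phi Q u f x)) \<le> ereal (e / 2)"
        by (rule order_trans[OF max_norm_le_op_norm[OF f] 1(2)]) (use u in auto)
      moreover have "ereal (max_norm (\<lambda>x. T (s - t) f x - Phi Q u f x)) \<le> ereal (e / 2)"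
        by (rule order_trans[OF max_norm_le_op_norm[OF f] 2(2)]) (use u in auto)
      ultimately show ?thesis
        using max_norm_diff_triangle[of "S f" "T (s - t) f" "Phi Q u f"]
          max_norm_minus_commute[of "Phi Q u f" "T (s - t) f"] by simp
    qed
    then have "max_norm (\<lambda>x. S f x - T (s - t) f x) \<le> 0" by (rule field_le_epsilon)
    then show "S f = T (s - t) f" unfolding max_norm_le_iff by (auto intro!: ext)
  qed (use S T_lower_transition assms in auto)
qed

end

section \<open>Derivatives of \<open>L\<close> in operator norm\<close>

text \<open>As \<open>K\<close> and \<delta> do not depend on \<open>f\<close>, the supremum over
  functions of norm 1 is squeezed between 0 and \<open>K * \<bar>h\<bar>\<close>.\<close>

lemma has_op_derivativeI:
  assumes "0 < \<delta>"
    and "\<And>h f. r + h \<in> S \<Longrightarrow> h \<noteq> 0 \<Longrightarrow> \<bar>h\<bar> \<le> \<delta> \<Longrightarrow> max_norm f = 1 \<Longrightarrow>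
      max_norm (\<lambda>x. (F (r + h) f x - F r f x) / h - B f x) \<le> K * \<bar>h\<bar>"
  shows "has_op_derivative F B r S"
  unfolding has_op_derivative_def
proof (rule tendsto_sandwich[where f = "\<lambda>_. 0"])
  let ?D = "{h. r + h \<in> S}"
  show "\<forall>\<^sub>F h in at 0 within ?D. op_norm (\<lambda>f x. (F (r + h) f x - F r f x) / h - B f x) \<le> ereal (K * \<bar>h\<bar>)"
    unfolding eventually_at using assms by (intro exI[of _ \<delta>]) (auto intro!: op_norm_le)
  have "((\<lambda>h. K * \<bar>h\<bar>) \<longlongrightarrow> K * \<bar>0\<bar>) (at 0 within ?D)" by (intro tendsto_intros)
  then show "((\<lambda>h. ereal (K * \<bar>h\<bar>)) \<longlongrightarrow> 0) (at 0 within ?D)"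
    by (simp add: zero_ereal_def)
qed (auto simp: op_norm_nonneg)

theorem proposition7p15:
  fixes Q :: "('x::finite) operator" and t s :: real
  assumes "lower_transition_rate_operator Q" and "0 \<le> t" and "t \<le> s"
  shows "has_op_derivative (\<lambda>t'. L Q t' s) (\<lambda>f x. - Q (L Q t s f) x) t {0..s} \<and>
         has_op_derivative (\<lambda>s'. L Q t s') (\<lambda>f x. Q (L Q t s f) x) s {t..}"
proof -
  interpret lower_rate Q by unfold_locales (rule assms(1))
  have small: "\<bar>h\<bar> * M \<le> 1" if "\<bar>h\<bar> \<le> 1 / M" for h
    using that M_pos by (simp add: pos_le_divide_eq)
  show ?thesis
  proof
    show "has_op_derivative (\<lambda>t'. L Q t' s) (\<lambda>f x. - Q (L Q t s f) x) t {0..s}"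
    proof (rule has_op_derivativeI)
      show "0 < 1 / M" using M_pos by simp
      fix h and f :: "'x \<Rightarrow> real"
      assume h: "t + h \<in> {0..s}" "h \<noteq> 0" "\<bar>h\<bar> \<le> 1 / M" and f: "max_norm f = 1"
      \<comment> \<open>Moving \<open>t\<close> by \<open>h\<close> changes the duration
        \<open>s - t\<close> by \<open>- h\<close>. Dividing by \<open>h\<close> in place of
        \<open>- h\<close> then flips the sign, which yields the derivative
        \<open>- Q (L Q t s f)\<close>.\<close>
      have "max_norm (\<lambda>x. (T (s - t + - h) f x - T (s - t) f x) / (- h) - Q (T (s - t) f) x) \<le> 5 * M\<^sup>2 * \<bar>h\<bar>"
        using T_difference_quotient[of "s - t" "- h" f] assms h small[OF h(3)] f by simp
      then have "max_norm (\<lambda>x. - ((T (s - t + - h) f x - T (s - t) f x) / (- h) - Q (T (s - t) f) x)) \<le> 5 * M\<^sup>2 * \<bar>h\<bar>"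
        by (simp only: max_norm_uminus)
      then show "max_norm (\<lambda>x. (L Q (t + h) s f x - L Q t s f x) / h - - Q (L Q t s f) x) \<le> 5 * M\<^sup>2 * \<bar>h\<bar>"
        using h assms by (simp add: L_eq_T algebra_simps)
    qed
    show "has_op_derivative (\<lambda>s'. L Q t s') (\<lambda>f x. Q (L Q t s f) x) s {t..}"
    proof (rule has_op_derivativeI)
      show "0 < 1 / M" using M_pos by simp
      fix h and f :: "'x \<Rightarrow> real"
      assume h: "s + h \<in> {t..}" "h \<noteq> 0" "\<bar>h\<bar> \<le> 1 / M" and f: "max_norm f = 1"
      show "max_norm (\<lambda>x. (L Q t (s + h) f x - L Q t s f x) / h - Q (L Q t s f) x) \<le> 5 * M\<^sup>2 * \<bar>h\<bar>"
        using T_difference_quotient[of "s - t" h f] assms h small[OF h(3)] f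
        by (simp add: L_eq_T algebra_simps)
    qed
  qed
qed

end
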